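(* There is no constant $c\in(0,1)$ such that every finite group $G$ with $d'(G)>c$ is nilpotent; there is no constant $c\in(0,1)$ such that every finite group $G$ with $d'(G)>c$ is an Iwasawa group; and there is no constant $c\in(0,1)$ such that every finite group $G$ with $d'(G)>c$ is a Dedekind group.
   Context: All groups are finite. For a finite group $G$, $L(G)$ denotes the set (lattice) of all subgroups of $G$, $k'(G)$ the number of conjugacy classes of subgroups of $G$, and $d'(G)=\frac{k'(G)}{|L(G)|}$. An Iwasawa group is a nilpotent group whose subgroup lattice is modular. A Dedekind group is a group all of whose subgroups are normal. *)

theory Defs
  imports Complex_Main "HOL-Algebra.Algebra"
begin

definition subgroup_lattice :: "('a, 'b) monoid_scheme \<Rightarrow> 'a set gorder" where
  "subgroup_lattice G = \<lparr>carrier = {H. subgroup H G}, eq = (=), le = (\<subseteq>)\<rparr>"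

definition subgroup_classes :: "('a, 'b) monoid_scheme \<Rightarrow> 'a set set set" where
  "subgroup_classes G =
     orbits G {H. subgroup H G}
       (\<lambda>g. \<lambda>H \<in> {H. subgroup H G}. g <#\<^bsub>G\<^esub> H #>\<^bsub>G\<^esub> (inv\<^bsub>G\<^esub> g))"

definition subgroup_class_number :: "('a, 'b) monoid_scheme \<Rightarrow> nat" where
  "subgroup_class_number G = card (subgroup_classes G)"

definition subgroup_class_ratio :: "('a, 'b) monoid_scheme \<Rightarrow> real" where
  "subgroup_class_ratio G =
     real (subgroup_class_number G) / real (card (carrier (subgroup_lattice G)))"

definition group_center :: "('a, 'b) monoid_scheme \<Rightarrow> 'a set" where
  "group_center G = {z \<in> carrier G. \<forall>g \<in> carrier G. z \<otimes>\<^bsub>G\<^esub> g = g \<otimes>\<^bsub>G\<^esub> z}"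

definition central_series :: "('a, 'b) monoid_scheme \<Rightarrow> nat \<Rightarrow> (nat \<Rightarrow> 'a set) \<Rightarrow> bool" where
  "central_series G n N \<longleftrightarrow>
     N 0 = {\<one>\<^bsub>G\<^esub>} \<and> N n = carrier G \<and> (\<forall>i\<le>n. N i \<lhd> G) \<and>
     (\<forall>i<n. N i \<subseteq> N (Suc i) \<and>
        carrier (G\<lparr>carrier := N (Suc i)\<rparr> Mod N i) \<subseteq> group_center (G Mod N i))"

definition nilpotent_group :: "('a, 'b) monoid_scheme \<Rightarrow> bool" where
  "nilpotent_group G \<longleftrightarrow> group G \<and> (\<exists>n N. central_series G n N)"

definition modular_lattice :: "('a, 'b) gorder_scheme \<Rightarrow> bool" where
  "modular_lattice L \<longleftrightarrow> Lattice.lattice L \<and>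
     (\<forall>x \<in> carrier L. \<forall>y \<in> carrier L. \<forall>z \<in> carrier L.
        x \<sqsubseteq>\<^bsub>L\<^esub> z \<longrightarrow> x \<squnion>\<^bsub>L\<^esub> (y \<sqinter>\<^bsub>L\<^esub> z) = (x \<squnion>\<^bsub>L\<^esub> y) \<sqinter>\<^bsub>L\<^esub> z)"

definition iwasawa_group :: "('a, 'b) monoid_scheme \<Rightarrow> bool" where
  "iwasawa_group G \<longleftrightarrow> nilpotent_group G \<and> modular_lattice (subgroup_lattice G)"

definition dedekind_group :: "('a, 'b) monoid_scheme \<Rightarrow> bool" where
  "dedekind_group G \<longleftrightarrow> group G \<and> (\<forall>H. subgroup H G \<longrightarrow> H \<lhd> G)"

text \<open>
  A quantifier over all finite groups has to range over groups with elements in one fixed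
  type. By the following lemma, the type \<^typ>\<open>nat\<close> loses no isomorphism class; all notions
  above are isomorphism invariant.
\<close>

lemma finite_group_iso_nat_monoid:
  fixes G (structure)
  assumes "group G" and "finite (carrier G)"
  shows "\<exists>H :: nat monoid. group H \<and> finite (carrier H) \<and> G \<cong> H"
proof -
  interpret group G by fact
  obtain f where f: "bij_betw f (carrier G) {0..<card (carrier G)}"
    using ex_bij_betw_finite_nat[OF assms(2)] by blast
  define g where "g = the_inv_into (carrier G) f"
  define H :: "nat monoid" where
    "H = \<lparr>carrier = f ` carrier G, monoid.mult = (\<lambda>x y. f (g x \<otimes> g y)), one = f \<one>\<rparr>"
  have inj: "inj_on f (carrier G)"
    using f by (simp add: bij_betw_def)
  have gf: "g (f x) = x" if "x \<in> carrier G" for x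
    unfolding g_def using inj that by (rule the_inv_into_f_f)
  have "group H"
  proof (rule groupI)
    fix x assume "x \<in> carrier H"
    then obtain a where a: "a \<in> carrier G" "x = f a"
      by (auto simp: H_def)
    show "\<exists>y\<in>carrier H. y \<otimes>\<^bsub>H\<^esub> x = \<one>\<^bsub>H\<^esub>"
      by (rule bexI[of _ "f (inv a)"]) (use a in \<open>auto simp: H_def gf\<close>)
  qed (auto simp: H_def gf m_assoc)
  moreover have "f \<in> iso G H"
    using inj by (auto simp: iso_def hom_def bij_betw_def H_def gf)
  moreover have "finite (carrier H)"
    using assms(2) by (simp add: H_def)
  ultimately show ?thesis
    by (auto simp: is_iso_def)
qed

end

theory Submission
  imports Defs
begin

text \<open>
  The witnesses are the groups $C_3 \rtimes C_{2^n}$, $n \geq 1$, where a generator of $C_{2^n}$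
  inverts $C_3$. A subgroup that contains $C_3$ is normal, and a subgroup that meets $C_3$
  trivially is either central or one of the three Sylow 2-subgroups. So at most three of the
  at least $n$ subgroups are not normal, and the ratio is at least $1 - 3/n$. No such group is
  nilpotent, since $[C_3, G] = C_3$ keeps $C_3$ in every term of a central series.
\<close>

section \<open>Normal subgroups, conjugacy classes and central series in general groups\<close>

lemma card_normal_le_subgroup_class_number:
  fixes G (structure)
  assumes "group G" and fin: "finite (carrier G)"
  shows "card {H. H \<lhd> G} \<le> subgroup_class_number G"
proof -
  interpret group G by fact
  have finL: "finite {H. subgroup H G}"
    by (rule finite_subset[of _ "Pow (carrier G)"]) (use fin in \<open>auto dest: subgroup.subset\<close>)
  let ?act = "\<lambda>g. \<lambda>H \<in> {H. subgroup H G}. g <# H #> inv g"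
  \<comment> \<open>Conjugation fixes a normal subgroup, so its class is a singleton; distinct
    normal subgroups then give distinct classes.\<close>
  have "{H} \<in> subgroup_classes G" if H: "H \<lhd> G" for H
  proof -
    have sub: "subgroup H G"
      using H by (rule normal_imp_subgroup)
    have "g <# H #> inv g = H" if g: "g \<in> carrier G" for g
    proof -
      have "g <# H #> inv g = H #> g #> inv g"
        using normal.coset_eq[OF H] g by simp
      then show ?thesis
        using g sub by (simp add: coset_mult_assoc subgroup.subset)
    qed
    then have "orbit G ?act H = {H}"
      using sub by (auto simp: orbit_def intro!: exI[of _ \<one>])
    then show ?thesis
      using sub by (auto simp: subgroup_classes_def orbits_def)
  qed
  then have "(\<lambda>H. {H}) ` {H. H \<lhd> G} \<subseteq> subgroup_classes G"
    by blast
  moreover have "finite (subgroup_classes G)"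
    using finL by (simp add: subgroup_classes_def orbits_def setcompr_eq_image)
  ultimately have "card ((\<lambda>H. {H}) ` {H. H \<lhd> G}) \<le> card (subgroup_classes G)"
    by (rule card_mono[rotated])
  then show ?thesis
    by (simp add: subgroup_class_number_def card_image)
qed

lemma subgroup_class_ratio_ge:
  fixes G (structure)
  assumes "group G" and fin: "finite (carrier G)"
  shows "subgroup_class_ratio G \<ge>
    1 - real (card {H. subgroup H G \<and> \<not> H \<lhd> G}) / real (card {H. subgroup H G})"
proof -
  interpret group G by fact
  let ?L = "{H. subgroup H G}" and ?N = "{H. H \<lhd> G}" and ?X = "{H. subgroup H G \<and> \<not> H \<lhd> G}"
  have finL: "finite ?L"
    by (rule finite_subset[of _ "Pow (carrier G)"]) (use fin in \<open>auto dest: subgroup.subset\<close>)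
  have L: "?L = ?N \<union> ?X"
    by (auto intro: normal_imp_subgroup)
  have "card ?L = card ?N + card ?X"
    by (subst L, rule card_Un_disjoint) (use finL in \<open>auto intro: finite_subset[OF _ finL] simp: normal_imp_subgroup\<close>)
  then have "real (card ?L) - real (card ?X) \<le> real (subgroup_class_number G)"
    using card_normal_le_subgroup_class_number[OF assms] by simp
  moreover have "card ?L > 0"
    using finL triv_subgroup by (auto simp: card_gt_0_iff)
  moreover from calculation(1)
  have "(real (card ?L) - real (card ?X)) / real (card ?L)
      \<le> real (subgroup_class_number G) / real (card ?L)"
    by (rule divide_right_mono) simp
  ultimately show ?thesis
    by (simp add: subgroup_class_ratio_def subgroup_lattice_def diff_divide_distrib)
qed

text \<open>The coset of \<open>x\<close> is central in the quotient by \<open>N i\<close>, so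
  \<open>x \<otimes> g\<close> and \<open>g \<otimes> x\<close> lie in one coset of
  \<open>N i\<close>. The element \<open>h\<close> is the commutator of \<open>g\<close> and
  \<open>x\<close>: each term of the series contains the commutators of the next term with
  \<open>G\<close>.\<close>

lemma central_series_commute:
  fixes G (structure)
  assumes "group G" and N: "central_series G n N" and i: "i < n"
    and x: "x \<in> N (Suc i)" and g: "g \<in> carrier G"
  shows "\<exists>h\<in>N i. h \<otimes> (x \<otimes> g) = g \<otimes> x"
proof -
  interpret group G by fact
  have nor: "N i \<lhd> G" "N (Suc i) \<lhd> G"
    using N i by (auto simp: central_series_def)
  interpret normal "N i" G by (rule nor)
  have xG: "x \<in> carrier G"
    using x nor(2) normal_imp_subgroup subgroup.mem_carrier by metis
  have "N i #> x \<in> carrier (G\<lparr>carrier := N (Suc i)\<rparr> Mod N i)"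
    using x by (auto simp: FactGroup_def RCOSETS_def r_coset_def)
  then have "N i #> x \<in> group_center (G Mod N i)"
    using N i by (auto simp: central_series_def)
  moreover have "N i #> g \<in> carrier (G Mod N i)"
    using g by (auto simp: FactGroup_def RCOSETS_def)
  ultimately have "(N i #> x) <#> (N i #> g) = (N i #> g) <#> (N i #> x)"
    by (auto simp: group_center_def FactGroup_def)
  then have "N i #> (x \<otimes> g) = N i #> (g \<otimes> x)"
    using xG g by (simp add: rcos_sum)
  moreover have "g \<otimes> x \<in> N i #> (g \<otimes> x)"
    using xG g is_subgroup by (simp add: rcos_self)
  ultimately have "g \<otimes> x \<in> N i #> (x \<otimes> g)"
    by simp
  then show ?thesis
    by (auto simp: r_coset_def)
qed

text \<open>Normality in the form gH \<subseteq> Hg, which in coordinates can be checked with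
  products alone, without inverses.\<close>

lemma (in group) normalI_commute:
  assumes H: "subgroup H G"
    and c: "\<And>g h. g \<in> carrier G \<Longrightarrow> h \<in> H \<Longrightarrow> \<exists>h'\<in>H. g \<otimes> h = h' \<otimes> g"
  shows "H \<lhd> G"
  unfolding normal_inv_iff
proof (intro conjI ballI H)
  fix g h assume g: "g \<in> carrier G" and h: "h \<in> H"
  from c[OF this] obtain h' where h': "h' \<in> H" "g \<otimes> h = h' \<otimes> g"
    by blast
  then show "g \<otimes> h \<otimes> inv g \<in> H"
    using g subgroup.mem_carrier[OF H] by (simp add: m_assoc)
qed

section \<open>The semidirect product of C_3 by C_{2^n}, coded on natural numbers\<close>

definition sgn3 :: "nat \<Rightarrow> nat" where
  "sgn3 i = (if even i then 1 else 2)"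

text \<open>
  \<open>elt n a i\<close> encodes the element $(a, i)$ of $C_3 \rtimes C_{2^n}$; both arguments are read
  modulo the respective orders. The factor \<open>sgn3 i\<close> is $(-1)^i$ modulo 3.
\<close>

definition elt :: "nat \<Rightarrow> nat \<Rightarrow> nat \<Rightarrow> nat" where
  "elt n a i = 3 * (i mod 2 ^ n) + a mod 3"

text \<open>On codes, \<open>x mod 3\<close> and \<open>x div 3\<close> recover the two coordinates,
  and the product is (a, i)(b, j) = (a + (-1)^i b, i + j).\<close>

definition C3_by_C2n :: "nat \<Rightarrow> nat monoid" where
  "C3_by_C2n n = \<lparr>carrier = {..< 3 * 2 ^ n},
     monoid.mult = (\<lambda>x y. elt n (x mod 3 + sgn3 (x div 3) * (y mod 3)) (x div 3 + y div 3)),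
     one = elt n 0 0\<rparr>"

lemma elt_eq_iff: "elt n a i = elt n b j \<longleftrightarrow> a mod 3 = b mod 3 \<and> i mod 2 ^ n = j mod 2 ^ n"
proof
  assume "elt n a i = elt n b j"
  then have "elt n a i mod 3 = elt n b j mod 3" "elt n a i div 3 = elt n b j div 3"
    by simp_all
  then show "a mod 3 = b mod 3 \<and> i mod 2 ^ n = j mod 2 ^ n"
    by (simp add: elt_def)
qed (simp add: elt_def)

text \<open>The sign is multiplicative only modulo 3: for odd \<open>i\<close> and \<open>j\<close>
  the product is 4.\<close>

lemma sgn3_add: "sgn3 (i + j) mod 3 = sgn3 i * sgn3 j mod 3"
  by (simp add: sgn3_def)

context
  fixes n :: nat
  assumes n: "n > 0"
begin

abbreviation "E \<equiv> elt n"

abbreviation "G \<equiv> C3_by_C2n n"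

text \<open>As \<open>n > 0\<close>, the modulus is even and reduction keeps parity; this makes the
  action of C_{2^n} on C_3 well defined.\<close>

lemma sgn3_mod: "sgn3 (i mod 2 ^ n) = sgn3 i"
  using n by (simp add: sgn3_def dvd_mod_iff)

lemma elt_mult: "E a i \<otimes>\<^bsub>G\<^esub> E b j = E (a + sgn3 i * b) (i + j)"
  by (simp add: C3_by_C2n_def) (simp add: elt_eq_iff elt_def sgn3_mod mod_simps,
    metis mod_add_right_eq mod_mult_right_eq)

lemma elt_one: "\<one>\<^bsub>G\<^esub> = E 0 0"
  by (simp add: C3_by_C2n_def)

lemma carrier_C3_by_C2n: "carrier G = {E a i |a i. True}"
proof (intro equalityI subsetI)
  fix x assume "x \<in> carrier G"
  then have "x div 3 < 2 ^ n"
    by (simp add: C3_by_C2n_def less_mult_imp_div_less mult.commute)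
  then have "x = E (x mod 3) (x div 3)"
    by (simp add: elt_def)
  then show "x \<in> {E a i |a i. True}"
    by blast
next
  fix x assume "x \<in> {E a i |a i. True}"
  then obtain a i where x: "x = E a i" by blast
  have "i mod 2 ^ n < 2 ^ n" "a mod 3 < 3"
    by simp_all
  then show "x \<in> carrier G"
    unfolding x by (simp only: C3_by_C2n_def elt_def partial_object.simps lessThan_iff)
qed

lemma elt_carrier [simp]: "E a i \<in> carrier G"
  by (auto simp: carrier_C3_by_C2n)

lemma finite_carrier_C3_by_C2n: "finite (carrier G)"
  by (simp add: C3_by_C2n_def)

text \<open>In the naturals, 2 stands for -1 modulo 3 and \<open>2 ^ n - 1\<close> for -1 modulo
  \<open>2 ^ n\<close>. The latter is odd, so the inverse acts with the same sign.\<close>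

lemma elt_left_inverse:
  "E (2 * sgn3 i * a) ((2 ^ n - 1) * i) \<otimes>\<^bsub>G\<^esub> E a i = \<one>\<^bsub>G\<^esub>"
proof -
  have "(2 ^ n - 1) * i + i = 2 ^ n * i"
    by (simp add: algebra_simps)
  moreover have "sgn3 ((2 ^ n - 1) * i) = sgn3 i"
    using n by (simp add: sgn3_def)
  ultimately show ?thesis
    by (simp add: elt_mult elt_one elt_eq_iff)
qed

lemma group_C3_by_C2n: "group G"
proof (rule groupI)
  fix x y z assume "x \<in> carrier G" "y \<in> carrier G" "z \<in> carrier G"
  then obtain a i b j c k where "x = E a i" "y = E b j" "z = E c k"
    by (auto simp: carrier_C3_by_C2n)
  moreover have "sgn3 (i + j) * c mod 3 = sgn3 i * (sgn3 j * c) mod 3"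
    by (metis mod_mult_left_eq mult.assoc sgn3_add)
  then have "(a + sgn3 i * b + sgn3 (i + j) * c) mod 3 = (a + sgn3 i * (b + sgn3 j * c)) mod 3"
    unfolding distrib_left add.assoc[symmetric] by (rule mod_add_cong[OF refl])
  ultimately show "x \<otimes>\<^bsub>G\<^esub> y \<otimes>\<^bsub>G\<^esub> z = x \<otimes>\<^bsub>G\<^esub> (y \<otimes>\<^bsub>G\<^esub> z)"
    by (simp add: elt_mult elt_eq_iff add.assoc)
next
  fix x assume "x \<in> carrier G"
  then obtain a i where x: "x = E a i"
    by (auto simp: carrier_C3_by_C2n)
  show "\<exists>y\<in>carrier G. y \<otimes>\<^bsub>G\<^esub> x = \<one>\<^bsub>G\<^esub>"
    unfolding x using elt_left_inverse elt_carrier by blast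
  show "\<one>\<^bsub>G\<^esub> \<otimes>\<^bsub>G\<^esub> x = x"
    by (simp add: x elt_one elt_mult elt_eq_iff sgn3_def)
qed (auto simp: carrier_C3_by_C2n elt_one elt_mult, blast)

interpretation group G by (rule group_C3_by_C2n)

section \<open>Closure properties of subgroups in coordinates\<close>

lemma subgroup_elt_mult:
  "subgroup H G \<Longrightarrow> E a i \<in> H \<Longrightarrow> E b j \<in> H \<Longrightarrow> E (a + sgn3 i * b) (i + j) \<in> H"
  by (metis elt_mult subgroup.m_closed)

lemma subgroup_elt_inv:
  assumes "subgroup H G" "E a i \<in> H"
  shows "E (2 * sgn3 i * a) ((2 ^ n - 1) * i) \<in> H"
  by (metis assms elt_carrier elt_left_inverse inv_equality subgroup.m_inv_closed)

text \<open>This is (a, i)(b, i)^{-1} = (a - b, 0), with \<open>2 * b\<close> for -b; the two signs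
  cancel because their square is 1 modulo 3.\<close>

lemma subgroup_elt_quotient:
  assumes "subgroup H G" "E a i \<in> H" "E b i \<in> H"
  shows "E (a + 2 * b) 0 \<in> H"
proof -
  have "i + (2 ^ n - 1) * i = 2 ^ n * i"
    by (simp add: algebra_simps)
  moreover have "(a + sgn3 i * (2 * sgn3 i * b)) mod 3 = (a + 2 * b) mod 3"
    by (cases "even i") (simp_all add: sgn3_def, presburger+)
  ultimately have "E (a + sgn3 i * (2 * sgn3 i * b)) (i + (2 ^ n - 1) * i) = E (a + 2 * b) 0"
    by (simp add: elt_eq_iff)
  then show ?thesis
    using subgroup_elt_mult[OF assms(1,2) subgroup_elt_inv[OF assms(1,3)]] by simp
qed

lemma subgroup_elt_zero: "subgroup H G \<Longrightarrow> E 0 0 \<in> H"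
  by (metis elt_one subgroup.one_closed)

text \<open>An even second coordinate acts trivially on C_3, so powers are taken
  coordinatewise.\<close>

lemma subgroup_pow_even:
  assumes "subgroup H G" "E a i \<in> H" "even i"
  shows "E (k * a) (k * i) \<in> H"
  by (induction k)
     (use subgroup_elt_zero[OF assms(1)] subgroup_elt_mult[OF assms(1,2)] assms(3)
       in \<open>auto simp: sgn3_def\<close>)

text \<open>For odd \<open>i\<close> the square of (a, i) is (a - a, 2i) = (0, 2i), so the first
  coordinate of a power depends only on the parity of \<open>k\<close>.\<close>

lemma subgroup_pow_odd:
  assumes "subgroup H G" "E a i \<in> H" "odd i"
  shows "E (if odd k then a else 0) (k * i) \<in> H"
proof (induction k)
  case 0
  then show ?case
    using subgroup_elt_zero[OF assms(1)] by simp
next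
  case (Suc k)
  have "E (a + sgn3 i * (if odd k then a else 0)) (i + k * i) \<in> H"
    by (rule subgroup_elt_mult[OF assms(1,2) Suc])
  moreover have "E (a + sgn3 i * (if odd k then a else 0)) (i + k * i)
      = E (if odd (Suc k) then a else 0) (Suc k * i)"
    using assms(3) by (simp add: elt_eq_iff sgn3_def)
  ultimately show ?case by simp
qed

section \<open>Normal subgroups, and the three possible exceptions\<close>

lemma normal_if_C3_subset:
  assumes H: "subgroup H G" and c: "E 1 0 \<in> H"
  shows "H \<lhd> G"
proof (rule normalI_commute[OF H])
  \<comment> \<open>Since \<open>H\<close> contains C_3, membership depends only on the second
    coordinate: multiply by (d - b, 0).\<close>
  have all: "E d j \<in> H" if "E b j \<in> H" for b d j
  proof -
    have "E (d + 2 * b) 0 \<in> H"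
      using subgroup_pow_even[OF H c, of "d + 2 * b"] by simp
    from subgroup_elt_mult[OF H this that]
    have "E (d + 2 * b + b) j \<in> H"
      by (simp add: sgn3_def)
    then show ?thesis
      by (simp add: elt_def)
  qed
  fix g h assume "g \<in> carrier G" "h \<in> H"
  moreover from this have "h \<in> carrier G"
    using subgroup.mem_carrier[OF H] by blast
  ultimately obtain a i b j where gh: "g = E a i" "h = E b j" "E b j \<in> H"
    by (auto simp: carrier_C3_by_C2n)
  show "\<exists>h'\<in>H. g \<otimes>\<^bsub>G\<^esub> h = h' \<otimes>\<^bsub>G\<^esub> g"
  proof
    \<comment> \<open>The first coordinate solves a + (-1)^i b = c + (-1)^j a for c, again with 2
      for -1.\<close>
    show "E (a + sgn3 i * b + 2 * sgn3 j * a) j \<in> H"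
      using gh(3) by (rule all)
    show "g \<otimes>\<^bsub>G\<^esub> h = E (a + sgn3 i * b + 2 * sgn3 j * a) j \<otimes>\<^bsub>G\<^esub> g"
      by (simp add: gh elt_mult elt_eq_iff add.commute)
  qed
qed

text \<open>Without \<open>E 1 0\<close>, the subgroup meets C_3 trivially, as C_3 has prime order.
  Hence the projection of \<open>H\<close> to C_{2^n} is injective.\<close>

lemma subgroup_elt_unique:
  assumes H: "subgroup H G" and c: "E 1 0 \<notin> H" and ab: "E a i \<in> H" "E b i \<in> H"
  shows "a mod 3 = b mod 3"
proof (rule ccontr)
  assume "a mod 3 \<noteq> b mod 3"
  then have "(a + 2 * b) mod 3 \<noteq> 0"
    by presburger
  \<comment> \<open>A nonzero residue modulo 3 is 1 or 2, and twice 2 is 1; so the quotient or its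
    square is \<open>E 1 0\<close>.\<close>
  then have "(a + 2 * b) mod 3 = 1 \<or> (2 * (a + 2 * b)) mod 3 = 1"
    by presburger
  then have "E 1 0 = E (a + 2 * b) 0 \<or> E 1 0 = E (2 * (a + 2 * b)) 0"
    by (auto simp: elt_eq_iff)
  then show False
    using c subgroup_elt_quotient[OF H ab]
      subgroup_pow_even[OF H subgroup_elt_quotient[OF H ab], of 2] by auto
qed

text \<open>The powers of (d, 1), which form a cyclic Sylow 2-subgroup.\<close>

definition sylow2 :: "nat \<Rightarrow> nat set" where
  "sylow2 d = {E (if odd k then d else 0) k |k. True}"

lemma sylow2_mod: "sylow2 (d mod 3) = sylow2 d"
proof -
  have "E (if odd k then d mod 3 else 0) k = E (if odd k then d else 0) k" for k
    by (simp add: elt_eq_iff)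
  then show ?thesis
    by (simp add: sylow2_def)
qed

lemma normal_or_sylow2:
  assumes H: "subgroup H G" and nor: "\<not> H \<lhd> G"
  shows "H \<in> sylow2 ` {..<3}"
proof -
  have c: "E 1 0 \<notin> H"
    using normal_if_C3_subset[OF H] nor by blast
  \<comment> \<open>If all second coordinates were even, \<open>H\<close> would be central and hence
    normal.\<close>
  have "\<exists>a i. E a i \<in> H \<and> odd i"
  proof (rule ccontr)
    assume "\<not> ?thesis"
    then have ev: "even i" if "E a i \<in> H" for a i
      using that by blast
    have zero: "b mod 3 = 0" if "E b j \<in> H" for b j
    proof -
      \<comment> \<open>The power with exponent \<open>2 ^ n\<close> lies in C_3, which meets
        \<open>H\<close> trivially; since \<open>2 ^ n\<close> is prime to 3, this forces b = 0
        modulo 3.\<close>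
      have "E (2 ^ n * b) (2 ^ n * j) \<in> H"
        using subgroup_pow_even[OF H that ev[OF that]] .
      then have "E (2 ^ n * b) 0 \<in> H"
        by (simp add: elt_def)
      then have "(2 ^ n * b) mod 3 = 0"
        using subgroup_elt_unique[OF H c _ subgroup_elt_zero[OF H]] by fastforce
      then have "3 dvd 2 ^ n * b"
        by presburger
      moreover have "coprime (3::nat) (2 ^ n)"
        by simp
      ultimately show ?thesis
        by (simp add: coprime_dvd_mult_right_iff)
    qed
    have "H \<lhd> G"
    proof (rule normalI_commute[OF H])
      fix g h assume "g \<in> carrier G" and h: "h \<in> H"
      moreover from this have "h \<in> carrier G"
        using subgroup.mem_carrier[OF H] by blast
      ultimately obtain a i b j where gh: "g = E a i" "h = E b j" "E b j \<in> H"
        by (auto simp: carrier_C3_by_C2n)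
      \<comment> \<open>Here b is 0 modulo 3 and \<open>sgn3 j\<close> is 1, so both sides reduce to
        \<open>a\<close>.\<close>
      have "(a + sgn3 i * b) mod 3 = (b + sgn3 j * a) mod 3"
        using zero[OF gh(3)] ev[OF gh(3)] by (auto simp: sgn3_def dest: mod_0_imp_dvd) presburger
      then have "g \<otimes>\<^bsub>G\<^esub> h = h \<otimes>\<^bsub>G\<^esub> g"
        by (simp add: gh elt_mult elt_eq_iff add.commute)
      then show "\<exists>h'\<in>H. g \<otimes>\<^bsub>G\<^esub> h = h' \<otimes>\<^bsub>G\<^esub> g"
        using h by blast
    qed
    then show False
      using nor by blast
  qed
  then obtain a i where ai: "E a i \<in> H" "odd i"
    by blast
  \<comment> \<open>An odd \<open>i\<close> is invertible modulo \<open>2 ^ n\<close>, so some power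
    of (a, i) has second coordinate 1.\<close>
  then have "gcd i (2 ^ n) = 1"
    by (simp flip: coprime_iff_gcd_eq_1)
  then obtain k y where "i * k = 2 ^ n * y + 1"
    using bezout_nat[of i "2 ^ n"] ai(2) by (metis odd_pos neq0_conv)
  then have "(k * i) mod 2 ^ n = 1 mod 2 ^ n"
    by (metis add.commute mod_mult_self2 mult.commute)
  then have "E b (k * i) = E b 1" for b
    by (simp add: elt_eq_iff)
  then obtain d where d: "E d 1 \<in> H"
    using subgroup_pow_odd[OF H ai, of k] by auto
  have pow: "E (if odd k then d else 0) k \<in> H" for k
    using subgroup_pow_odd[OF H d, of k] by simp
  \<comment> \<open>The powers of (d, 1) already realise every second coordinate, and injectivity of
    the projection leaves room for nothing else.\<close>
  have "H = sylow2 d"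
  proof (intro equalityI subsetI)
    fix x assume x: "x \<in> H"
    then have "x \<in> carrier G"
      using subgroup.mem_carrier[OF H] by blast
    then obtain b k where bk: "x = E b k"
      by (auto simp: carrier_C3_by_C2n)
    then have "b mod 3 = (if odd k then d else 0) mod 3"
      using subgroup_elt_unique[OF H c _ pow] x by blast
    then have "x = E (if odd k then d else 0) k"
      by (simp add: bk elt_eq_iff)
    then show "x \<in> sylow2 d"
      unfolding sylow2_def by blast
  qed (use pow in \<open>auto simp: sylow2_def\<close>)
  then have "H = sylow2 (d mod 3)"
    by (simp add: sylow2_mod)
  then show ?thesis
    by simp
qed

lemma card_non_normal_C3_by_C2n: "card {H. subgroup H G \<and> \<not> H \<lhd> G} \<le> 3"
proof -
  have "card {H. subgroup H G \<and> \<not> H \<lhd> G} \<le> card (sylow2 ` {..<3})"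
    by (rule card_mono) (use normal_or_sylow2 in auto)
  also have "\<dots> \<le> 3"
    using card_image_le[of "{..<3::nat}" sylow2] by simp
  finally show ?thesis .
qed

section \<open>A chain of \<open>n\<close> subgroups in the complement C_{2^n}, and the resulting
  ratio bound\<close>

definition C2_subgroup :: "nat \<Rightarrow> nat set" where
  "C2_subgroup k = {E 0 (2 ^ k * i) |i. True}"

lemma subgroup_C2_subgroup: "subgroup (C2_subgroup k) G"
proof (rule subgroupI)
  fix x assume "x \<in> C2_subgroup k"
  then obtain i where x: "x = E 0 (2 ^ k * i)"
    by (auto simp: C2_subgroup_def)
  have "inv\<^bsub>G\<^esub> x = E (2 * sgn3 (2 ^ k * i) * 0) ((2 ^ n - 1) * (2 ^ k * i))"
    unfolding x by (rule inv_equality[OF elt_left_inverse]) simp_all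
  also have "\<dots> = E 0 (2 ^ k * ((2 ^ n - 1) * i))"
    by (simp add: algebra_simps)
  finally show "inv\<^bsub>G\<^esub> x \<in> C2_subgroup k"
    by (auto simp: C2_subgroup_def)
next
  fix x y assume "x \<in> C2_subgroup k" "y \<in> C2_subgroup k"
  then show "x \<otimes>\<^bsub>G\<^esub> y \<in> C2_subgroup k"
    by (auto simp: C2_subgroup_def elt_mult simp flip: distrib_left)
qed (auto simp: C2_subgroup_def)

text \<open>Divisibility by \<open>2 ^ l\<close> survives reduction modulo \<open>2 ^ n\<close>, so
  the generator of the first subgroup must be divisible by \<open>2 ^ l\<close>. Used in both
  directions, this separates the subgroups for exponents below \<open>n\<close>.\<close>

lemma C2_subgroup_le:
  assumes "C2_subgroup k = C2_subgroup l" "l < n"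
  shows "l \<le> k"
proof -
  have "E 0 (2 ^ k * 1) \<in> C2_subgroup k"
    unfolding C2_subgroup_def by blast
  then obtain i where "2 ^ k mod 2 ^ n = (2 ^ l * i) mod (2 ^ n :: nat)"
    unfolding assms(1) by (auto simp: C2_subgroup_def elt_eq_iff)
  moreover have "(2 :: nat) ^ l dvd 2 ^ n"
    using assms(2) by (simp add: le_imp_power_dvd)
  ultimately have "(2 :: nat) ^ l dvd 2 ^ k"
    by (metis dvd_mod_iff dvd_triv_left)
  then show ?thesis
    by (simp add: power_dvd_imp_le)
qed

lemma card_subgroups_C3_by_C2n: "n \<le> card {H. subgroup H G}"
proof -
  have "inj_on C2_subgroup {..<n}"
    by (intro inj_onI antisym) (auto intro: C2_subgroup_le C2_subgroup_le[OF sym])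
  then have "n = card (C2_subgroup ` {..<n})"
    by (simp add: card_image)
  also have "\<dots> \<le> card {H. subgroup H G}"
  proof (rule card_mono)
    show "finite {H. subgroup H G}"
      by (rule finite_subset[of _ "Pow (carrier G)"])
         (use finite_carrier_C3_by_C2n in \<open>auto dest: subgroup.subset\<close>)
  qed (use subgroup_C2_subgroup in auto)
  finally show ?thesis .
qed

lemma subgroup_class_ratio_C3_by_C2n: "subgroup_class_ratio G \<ge> 1 - 3 / real n"
proof -
  have "real (card {H. subgroup H G \<and> \<not> H \<lhd> G}) / real (card {H. subgroup H G}) \<le> 3 / real n"
    by (rule frac_le) (use card_non_normal_C3_by_C2n card_subgroups_C3_by_C2n n in auto)
  then show ?thesis
    using subgroup_class_ratio_ge[OF group_C3_by_C2n finite_carrier_C3_by_C2n] by linarith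
qed

section \<open>Failure of nilpotency and of the Dedekind property\<close>

lemma C3_by_C2n_not_nilpotent: "\<not> nilpotent_group G"
proof
  assume "nilpotent_group G"
  then obtain l N where N: "central_series G l N"
    by (auto simp: nilpotent_group_def)
  have descend: "E 1 0 \<in> N i" if i: "i < l" and c: "E 1 0 \<in> N (Suc i)" for i
  proof -
    obtain h where h: "h \<in> N i" "h \<otimes>\<^bsub>G\<^esub> (E 1 0 \<otimes>\<^bsub>G\<^esub> E 0 1) = E 0 1 \<otimes>\<^bsub>G\<^esub> E 1 0"
      using central_series_commute[OF group_C3_by_C2n N i c elt_carrier] by blast
    moreover have "N i \<lhd> G"
      using N i by (simp add: central_series_def)
    ultimately have "h \<in> carrier G"
      using normal_imp_subgroup subgroup.mem_carrier by metis
    \<comment> \<open>As (0, 1) inverts x = (1, 0), their commutator is x^{-2} = x, so x itself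
      passes down to \<open>N i\<close>.\<close>
    moreover have "E 0 1 \<otimes>\<^bsub>G\<^esub> E 1 0 = E 1 0 \<otimes>\<^bsub>G\<^esub> (E 1 0 \<otimes>\<^bsub>G\<^esub> E 0 1)"
      by (simp add: elt_mult elt_eq_iff sgn3_def)
    ultimately have "h = E 1 0"
      using h(2) by (simp add: r_cancel)
    then show ?thesis
      using h(1) by simp
  qed
  have "E 1 0 \<in> N i" if "i \<le> l" for i
    using that
  proof (induction rule: inc_induct)
    case base
    then show ?case
      using N by (simp add: central_series_def)
  next
    case (step i)
    then show ?case
      using descend by blast
  qed
  then have "E 1 0 \<in> N 0"
    by simp
  then show False
    using N by (simp add: central_series_def elt_one elt_eq_iff)
qed

text \<open>The complement \<open>C2_subgroup 0\<close> is not normal: its left coset by (1, 0)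
  contains (1, 1), while its right coset consists of the (\<open>sgn3 i\<close>, i), with first
  coordinate 2 whenever i is odd.\<close>

lemma C3_by_C2n_not_dedekind: "\<not> dedekind_group G"
proof
  assume "dedekind_group G"
  then have nor: "C2_subgroup 0 \<lhd> G"
    using subgroup_C2_subgroup by (auto simp: dedekind_group_def)
  have "E 0 1 \<in> C2_subgroup 0"
    by (auto simp: C2_subgroup_def)
  then have "E 1 0 \<otimes>\<^bsub>G\<^esub> E 0 1 \<in> E 1 0 <#\<^bsub>G\<^esub> C2_subgroup 0"
    by (auto simp: l_coset_def)
  also have "\<dots> = C2_subgroup 0 #>\<^bsub>G\<^esub> E 1 0"
    using normal.coset_eq[OF nor] by simp
  finally obtain i where "E 1 1 = E (sgn3 i) i"
    by (auto simp: r_coset_def C2_subgroup_def elt_mult sgn3_def)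
  then have eq: "1 mod 3 = sgn3 i mod 3" "1 mod 2 ^ n = i mod 2 ^ n"
    by (simp_all only: elt_eq_iff)
  from eq(2) have "sgn3 1 = sgn3 i"
    by (metis sgn3_mod)
  with eq(1) show False
    by (cases "even i") (simp_all add: sgn3_def)
qed

end

section \<open>Choice of the group for a given constant\<close>

lemma exists_non_nilpotent_non_dedekind_large_ratio:
  fixes c :: real
  assumes "c < 1"
  shows "\<exists>G :: nat monoid. group G \<and> finite (carrier G) \<and> subgroup_class_ratio G > c
    \<and> \<not> nilpotent_group G \<and> \<not> dedekind_group G"
proof -
  \<comment> \<open>For positive \<open>n\<close> this bound is equivalent to c < 1 - 3/n.\<close>
  obtain n :: nat where n: "3 / (1 - c) < real n"
    using reals_Archimedean2 by blast
  moreover have "0 < 3 / (1 - c)"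
    using assms by simp
  ultimately have pos: "n > 0"
    using of_nat_0_less_iff by (metis order.strict_trans)
  have "c < 1 - 3 / real n"
    using n pos assms by (simp add: field_simps)
  also have "\<dots> \<le> subgroup_class_ratio (C3_by_C2n n)"
    using subgroup_class_ratio_C3_by_C2n[OF pos] .
  finally show ?thesis
    using group_C3_by_C2n[OF pos] finite_carrier_C3_by_C2n[OF pos] C3_by_C2n_not_nilpotent[OF pos] C3_by_C2n_not_dedekind[OF pos]
    by blast
qed

theorem mainTheorem6:
  shows "(\<not> (\<exists>c::real. 0 < c \<and> c < 1 \<and>
            (\<forall>G :: nat monoid. group G \<and> finite (carrier G) \<and> subgroup_class_ratio G > c
               \<longrightarrow> nilpotent_group G)))
       \<and> (\<not> (\<exists>c::real. 0 < c \<and> c < 1 \<and>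
            (\<forall>G :: nat monoid. group G \<and> finite (carrier G) \<and> subgroup_class_ratio G > c
               \<longrightarrow> iwasawa_group G)))
       \<and> (\<not> (\<exists>c::real. 0 < c \<and> c < 1 \<and>
            (\<forall>G :: nat monoid. group G \<and> finite (carrier G) \<and> subgroup_class_ratio G > c
               \<longrightarrow> dedekind_group G)))"
  \<comment> \<open>One witness refutes all three: nilpotency is a conjunct of
    \<open>iwasawa_group\<close>, so its failure settles the second claim as well.\<close>
  using exists_non_nilpotent_non_dedekind_large_ratio unfolding iwasawa_group_def by blast

end
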